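(* Let $\mathcal{M}=\{d^{-1}|\varphi_i\rangle\langle\varphi_i|\}_{i=1}^{d^2}$ and $\mathcal{N}=\{d^{-1}|\phi_j\rangle\langle\phi_j|\}_{j=1}^{d^2}$ be two SIC-POVMs in a $d$-dimensional complex Hilbert space $\mathcal{H}$, and put $$\bar f(\mathcal{M},\mathcal{N})=\frac1d\,\max_{i,j}\bigl|\langle\varphi_i|\phi_j\rangle\bigr|.$$ Then for every density matrix $\rho$ on $\mathcal{H}$ and all real $\alpha,\beta>0$ with $1/\alpha+1/\beta=2$, and $\mu=\max\{\alpha,\beta\}$, $$H_\alpha(\mathcal{M}|\rho)+H_\beta(\mathcal{N}|\rho)\;\ge\;\ln_\mu\!\left(\bar f(\mathcal{M},\mathcal{N})^{-2}\right),$$ $$R_\alpha(\mathcal{M}|\rho)+R_\beta(\mathcal{N}|\rho)\;\ge\;-2\ln\bar f(\mathcal{M},\mathcal{N}).$$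
   Context: A density matrix on $\mathcal{H}$ is a positive semidefinite operator of trace $1$. A SIC-POVM (symmetric informationally complete POVM) in $d$-dimensional $\mathcal{H}$ is a set of $d^2$ operators $d^{-1}|\phi_j\rangle\langle\phi_j|$, $j=1,\ldots,d^2$, with unit vectors $|\phi_j\rangle$ satisfying $|\langle\phi_j|\phi_k\rangle|^2=\frac{1}{d+1}$ for all $j\ne k$ and the completeness relation $\frac1d\sum_{j=1}^{d^2}|\phi_j\rangle\langle\phi_j|=\mathbf{1}$ (identity operator). Its outcome probabilities in state $\rho$ are $d^{-1}\langle\phi_j|\rho|\phi_j\rangle$. For $x>0$ and $\alpha>0$, $\alpha\ne1$, $\ln_\alpha(x)=\frac{x^{1-\alpha}-1}{1-\alpha}$, and $\ln_1(x)=\ln x$. For a probability distribution $p=\{p_j\}$ and $\alpha>0$, $\alpha\neq1$, the Tsallis entropy is $H_\alpha(p)=\frac{1}{1-\alpha}\bigl(\sum_j p_j^\alpha-1\bigr)$ and the Rényi entropy is $R_\alpha(p)=\frac{1}{1-\alpha}\ln\bigl(\sum_j p_j^\alpha\bigr)$, with sums over $j$ with $p_j>0$; for $\alpha=1$ both are the Shannon entropy $-\sum_j p_j\ln p_j$. $H_\alpha(\mathcal{M}|\rho)$, $R_\alpha(\mathcal{M}|\rho)$, etc., denote the entropies of the corresponding outcome distributions. *)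

theory Defs
  imports "HOL-Analysis.Analysis"
begin

text \<open>A $d$-dimensional complex Hilbert space is modelled as \<^typ>\<open>complex ^ 'n\<close> with
  $d$ the cardinality of \<open>'n\<close>; operators are matrices \<^typ>\<open>complex ^ 'n ^ 'n\<close>. The library's
  \<^const>\<open>inner\<close> on this type is the underlying real inner product (the real part of the Hermitian one),
  so the Hermitian inner product is defined here, conjugate-linear in the first argument.
  The library's \<^const>\<open>norm\<close> is the norm it induces.\<close>

definition cinner :: "complex ^ 'n \<Rightarrow> complex ^ 'n \<Rightarrow> complex" where
  "cinner x y = (\<Sum>i\<in>UNIV. cnj (x $ i) * y $ i)"

definition ketbra :: "complex ^ 'n \<Rightarrow> complex ^ 'n \<Rightarrow> complex ^ 'n ^ 'n" where
  "ketbra x y = (\<chi> i j. x $ i * cnj (y $ j))"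

definition positive_semidefinite :: "complex ^ 'n ^ 'n \<Rightarrow> bool" where
  "positive_semidefinite A \<longleftrightarrow>
     (\<forall>i j. A $ i $ j = cnj (A $ j $ i)) \<and> (\<forall>x. 0 \<le> Re (cinner x (A *v x)))"

definition density_matrix :: "complex ^ 'n ^ 'n \<Rightarrow> bool" where
  "density_matrix \<rho> \<longleftrightarrow> positive_semidefinite \<rho> \<and> trace \<rho> = 1"

text \<open>A SIC-POVM is given by its family of unit vectors $\phi_j$, indexed by $1,\ldots,d^2$;
  values of \<open>\<phi>\<close> outside this range are irrelevant. The argument \<open>\<phi>\<close> of \<open>sic_indices\<close>
  only serves to determine the dimension.\<close>

definition sic_indices :: "(nat \<Rightarrow> complex ^ 'n) \<Rightarrow> nat set" where
  "sic_indices \<phi> = {1..CARD('n)\<^sup>2}"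

definition sic_effect :: "(nat \<Rightarrow> complex ^ 'n) \<Rightarrow> nat \<Rightarrow> complex ^ 'n ^ 'n" where
  "sic_effect \<phi> j = (1 / real CARD('n)) *\<^sub>R ketbra (\<phi> j) (\<phi> j)"

definition sic_povm :: "(nat \<Rightarrow> complex ^ 'n) \<Rightarrow> bool" where
  "sic_povm \<phi> \<longleftrightarrow>
     (\<forall>j\<in>sic_indices \<phi>. norm (\<phi> j) = 1) \<and>
     (\<forall>j\<in>sic_indices \<phi>. \<forall>k\<in>sic_indices \<phi>. j \<noteq> k \<longrightarrow>
        (cmod (cinner (\<phi> j) (\<phi> k)))\<^sup>2 = 1 / (real CARD('n) + 1)) \<and>
     (\<Sum>j\<in>sic_indices \<phi>. sic_effect \<phi> j) = mat 1"

text \<open>The number $\langle\phi_j|\rho|\phi_j\rangle$ is real for Hermitian \<open>\<rho>\<close>; \<^const>\<open>Re\<close> only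
  changes its type.\<close>

definition sic_prob :: "(nat \<Rightarrow> complex ^ 'n) \<Rightarrow> complex ^ 'n ^ 'n \<Rightarrow> nat \<Rightarrow> real" where
  "sic_prob \<phi> \<rho> j = (1 / real CARD('n)) * Re (cinner (\<phi> j) (\<rho> *v \<phi> j))"

definition ln_alpha :: "real \<Rightarrow> real \<Rightarrow> real" where
  "ln_alpha \<alpha> x = (if \<alpha> = 1 then ln x else (x powr (1 - \<alpha>) - 1) / (1 - \<alpha>))"

definition shannon_entropy :: "'i set \<Rightarrow> ('i \<Rightarrow> real) \<Rightarrow> real" where
  "shannon_entropy I p = - (\<Sum>j\<in>{j\<in>I. p j > 0}. p j * ln (p j))"

definition tsallis_entropy :: "real \<Rightarrow> 'i set \<Rightarrow> ('i \<Rightarrow> real) \<Rightarrow> real" where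
  "tsallis_entropy \<alpha> I p =
     (if \<alpha> = 1 then shannon_entropy I p
      else 1 / (1 - \<alpha>) * ((\<Sum>j\<in>{j\<in>I. p j > 0}. p j powr \<alpha>) - 1))"

definition renyi_entropy :: "real \<Rightarrow> 'i set \<Rightarrow> ('i \<Rightarrow> real) \<Rightarrow> real" where
  "renyi_entropy \<alpha> I p =
     (if \<alpha> = 1 then shannon_entropy I p
      else 1 / (1 - \<alpha>) * ln (\<Sum>j\<in>{j\<in>I. p j > 0}. p j powr \<alpha>))"

definition sic_tsallis :: "real \<Rightarrow> (nat \<Rightarrow> complex ^ 'n) \<Rightarrow> complex ^ 'n ^ 'n \<Rightarrow> real" where
  "sic_tsallis \<alpha> \<phi> \<rho> = tsallis_entropy \<alpha> (sic_indices \<phi>) (sic_prob \<phi> \<rho>)"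

definition sic_renyi :: "real \<Rightarrow> (nat \<Rightarrow> complex ^ 'n) \<Rightarrow> complex ^ 'n ^ 'n \<Rightarrow> real" where
  "sic_renyi \<alpha> \<phi> \<rho> = renyi_entropy \<alpha> (sic_indices \<phi>) (sic_prob \<phi> \<rho>)"

definition sic_fbar :: "(nat \<Rightarrow> complex ^ 'n) \<Rightarrow> (nat \<Rightarrow> complex ^ 'n) \<Rightarrow> real" where
  "sic_fbar \<phi> \<psi> = (1 / real CARD('n)) *
     Max {cmod (cinner (\<phi> i) (\<psi> j)) | i j. i \<in> sic_indices \<phi> \<and> j \<in> sic_indices \<psi>}"

end

(* Maassen--Uffink argument. The rescaled vectors a_i, b_j of the two measurements resolve the
   identity. With p, q the outcome probabilities and
   K_ij = <b_j|a_i><a_i|rho|b_j>, the bilinear form sum w_i v_j K_ij has L^2 bound 1 (Cauchy--Schwarz for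
   the positive form <.|rho|.>, so mixed states need neither purification nor a square root of rho) and
   entries bounded by c sqrt(p_i q_j), where c bounds the overlaps |<a_i|b_j>|. Stein interpolation
   between the two bounds by Hadamard's three lines theorem gives, for 1/alpha + 1/beta = 2 and alpha > 1,
     sum_j q_j^alpha <= c^(2(alpha - 1)) (sum_i p_i^beta)^(alpha/beta).
   Taking logarithms yields the Renyi bound, and the Shannon case is its limit as alpha tends to 1;
   the Tsallis bound follows from the same inequality because Q <= k P^g with Q <= 1 <= P implies
   Q - k <= Q (1 - P^(-g)) <= g ln P <= g (P - 1). *)

theory Submission
  imports Defs "HOL-Complex_Analysis.Conformal_Mappings"
begin

section \<open>Hadamard's three lines theorem\<close>

text \<open>The strip is unbounded, so the maximum modulus principle cannot be applied to it
  directly. The factor exp(\<epsilon> (z^2 - 1)) has modulus at most 1 on the strip and decays as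
  |Im z| grows, so a long rectangle suffices; afterwards \<epsilon> tends to 0.\<close>

lemma three_lines_unit:
  fixes f :: "complex \<Rightarrow> complex"
  assumes hol: "f holomorphic_on UNIV"
    and bnd: "\<And>z. 0 \<le> Re z \<Longrightarrow> Re z \<le> 1 \<Longrightarrow> cmod (f z) \<le> C"
    and left: "\<And>z. Re z = 0 \<Longrightarrow> cmod (f z) \<le> 1"
    and right: "\<And>z. Re z = 1 \<Longrightarrow> cmod (f z) \<le> 1"
    and \<xi>: "0 \<le> Re \<xi>" "Re \<xi> \<le> 1"
  shows "cmod (f \<xi>) \<le> 1"
proof -
  have damped: "cmod (f \<xi> * exp (of_real \<epsilon> * (\<xi>\<^sup>2 - 1))) \<le> 1" if "\<epsilon> > 0" for \<epsilon> :: real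
  proof -
    define G where "G z = f z * exp (of_real \<epsilon> * (z\<^sup>2 - 1))" for z
    \<comment> \<open>The half-height \<open>R\<close> is chosen so that the damping beats
      \<open>C\<close> on the horizontal edges and the rectangle contains
      \<open>\<xi>\<close>.\<close>
    have "((\<lambda>R. C * exp (- \<epsilon> * R\<^sup>2)) \<longlongrightarrow> C * 0) at_top"
      using \<open>\<epsilon> > 0\<close>
      by (intro tendsto_intros filterlim_compose[OF exp_at_bot]
          filterlim_tendsto_neg_mult_at_bot[OF tendsto_const] filterlim_pow_at_top filterlim_ident) auto
    then have "eventually (\<lambda>R. C * exp (- \<epsilon> * R\<^sup>2) < 1) at_top"
      by (rule order_tendstoD) auto
    moreover have "eventually (\<lambda>R. R \<ge> \<bar>Im \<xi>\<bar>) at_top"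
      by (rule eventually_ge_at_top)
    ultimately have "eventually (\<lambda>R. C * exp (- \<epsilon> * R\<^sup>2) < 1 \<and> R \<ge> \<bar>Im \<xi>\<bar>) at_top"
      by (rule eventually_conj)
    then obtain R where R: "C * exp (- \<epsilon> * R\<^sup>2) < 1" "R \<ge> \<bar>Im \<xi>\<bar>"
      using eventually_happens'[OF trivial_limit_at_top_linorder] by blast
    have norm_exp: "cmod (exp (of_real \<epsilon> * (z\<^sup>2 - 1))) = exp (\<epsilon> * ((Re z)\<^sup>2 - (Im z)\<^sup>2 - 1))" for z
      by (simp add: power2_eq_square)
    define S where "S = cbox (Complex 0 (-R)) (Complex 1 R)"
    have S: "z \<in> S \<longleftrightarrow> 0 \<le> Re z \<and> Re z \<le> 1 \<and> -R \<le> Im z \<and> Im z \<le> R" for z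
      by (simp add: S_def in_cbox_complex_iff)
    have Gh: "G holomorphic_on UNIV"
      unfolding G_def by (intro holomorphic_intros hol)
    have "cmod (G \<xi>) \<le> 1"
    proof (rule maximum_modulus_frontier[of G S])
      show "G holomorphic_on interior S"
        using Gh by (rule holomorphic_on_subset) auto
      show "continuous_on (closure S) G"
        using Gh by (meson holomorphic_on_imp_continuous_on continuous_on_subset subset_UNIV)
      show "bounded S" by (simp add: S_def)
      show "\<xi> \<in> S" using \<xi> R(2) by (auto simp: S)
    next
      fix z assume z: "z \<in> frontier S"
      then have zS: "z \<in> S" and "z \<notin> box (Complex 0 (-R)) (Complex 1 R)"
        by (auto simp: S_def frontier_def)
      then have "Re z = 0 \<or> Re z = 1 \<or> \<bar>Im z\<bar> = R"
        by (auto simp: in_box_complex_iff S)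
      have x1: "(Re z)\<^sup>2 \<le> 1" using zS by (auto simp: S abs_square_le_1)
      show "cmod (G z) \<le> 1"
      proof (cases "\<bar>Im z\<bar> = R")
        case True
        then have "(Im z)\<^sup>2 = R\<^sup>2" by (metis power2_abs)
        then have "exp (\<epsilon> * ((Re z)\<^sup>2 - (Im z)\<^sup>2 - 1)) \<le> exp (- \<epsilon> * R\<^sup>2)"
          using x1 \<open>\<epsilon> > 0\<close> mult_left_mono[of "(Re z)\<^sup>2 - R\<^sup>2 - 1" "- R\<^sup>2" \<epsilon>] by simp
        moreover have "cmod (f z) \<le> C" using bnd zS by (auto simp: S)
        moreover have "C \<ge> 0" using norm_ge_zero order_trans calculation(2) by blast
        ultimately have "cmod (G z) \<le> C * exp (- \<epsilon> * R\<^sup>2)"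
          unfolding G_def norm_mult norm_exp by (intro mult_mono) auto
        then show ?thesis using R(1) by linarith
      next
        case False
        then have "cmod (f z) \<le> 1"
          using left right \<open>Re z = 0 \<or> Re z = 1 \<or> \<bar>Im z\<bar> = R\<close> by blast
        moreover have "exp (\<epsilon> * ((Re z)\<^sup>2 - (Im z)\<^sup>2 - 1)) \<le> 1"
          using x1 \<open>\<epsilon> > 0\<close> by (simp add: mult_le_0_iff) (smt (verit) zero_le_power2)
        ultimately show ?thesis
          unfolding G_def norm_mult norm_exp by (intro mult_le_one) auto
      qed
    qed
    then show ?thesis by (simp add: G_def)
  qed
  have "((\<lambda>\<epsilon>::real. cmod (f \<xi> * exp (of_real \<epsilon> * (\<xi>\<^sup>2 - 1)))) \<longlongrightarrow>
      cmod (f \<xi> * exp (of_real 0 * (\<xi>\<^sup>2 - 1)))) (at_right 0)"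
    by (intro tendsto_intros)
  moreover have "eventually (\<lambda>\<epsilon>::real. cmod (f \<xi> * exp (of_real \<epsilon> * (\<xi>\<^sup>2 - 1))) \<le> 1) (at_right 0)"
    using damped by (simp add: eventually_at_right_less eventually_mono[OF eventually_at_right_less])
  ultimately have "cmod (f \<xi> * exp (of_real 0 * (\<xi>\<^sup>2 - 1))) \<le> 1"
    by (rule tendsto_upperbound) simp
  then show ?thesis by simp
qed

text \<open>Dividing by the zero-free entire function A^(1-z) B^z, whose modulus depends only on Re
  z, normalises both boundary bounds to 1.\<close>

lemma three_lines:
  fixes f :: "complex \<Rightarrow> complex"
  assumes hol: "f holomorphic_on UNIV"
    and bnd: "\<And>z. 0 \<le> Re z \<Longrightarrow> Re z \<le> 1 \<Longrightarrow> cmod (f z) \<le> C"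
    and left: "\<And>z. Re z = 0 \<Longrightarrow> cmod (f z) \<le> A"
    and right: "\<And>z. Re z = 1 \<Longrightarrow> cmod (f z) \<le> B"
    and pos: "A > 0" "B > 0"
    and \<xi>: "0 \<le> Re \<xi>" "Re \<xi> \<le> 1"
  shows "cmod (f \<xi>) \<le> A powr (1 - Re \<xi>) * B powr Re \<xi>"
proof -
  define g where "g z = f z * exp (of_real (ln A) * (z - 1) - of_real (ln B) * z)" for z
  have norm_g: "cmod (g z) = cmod (f z) * (A powr (Re z - 1) * B powr (- Re z))" for z
    using pos by (simp add: g_def norm_mult powr_def algebra_simps flip: exp_add)
  have "cmod (g \<xi>) \<le> 1"
  proof (rule three_lines_unit[of g])
    show "g holomorphic_on UNIV"
      unfolding g_def by (intro holomorphic_intros hol)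
    \<comment> \<open>The exponents of \<open>A\<close> and \<open>B\<close> lie between -1 and 0,
      so each power is at most the larger of its two endpoint values.\<close>
    show "cmod (g z) \<le> C * (max 1 (1 / A) * max 1 (1 / B))" if "0 \<le> Re z" "Re z \<le> 1" for z
    proof -
      have *: "D powr (-t) \<le> max 1 (1 / D)" if "D > 0" "0 \<le> t" "t \<le> 1" for D t :: real
      proof (cases "D \<ge> 1")
        case True
        then show ?thesis using powr_mono[of "-t" 0 D] that by simp
      next
        case False
        then show ?thesis using powr_mono'[of "-1" "-t" D] that by (simp add: powr_minus field_simps)
      qed
      show ?thesis
        unfolding norm_g using bnd[OF that] *[of A "1 - Re z"] *[of B "Re z"] that pos
        by (intro mult_mono) (auto intro: order_trans[OF norm_ge_zero])
    qed
    show "cmod (g z) \<le> 1" if "Re z = 0" for z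
      using left[OF that] pos that by (simp add: norm_g powr_minus field_simps)
    show "cmod (g z) \<le> 1" if "Re z = 1" for z
      using right[OF that] pos that by (simp add: norm_g powr_minus field_simps)
  qed (use \<xi> in auto)
  then show ?thesis
    using pos by (simp add: norm_g powr_minus powr_diff field_simps)
qed

section \<open>Hermitian inner product and positive semidefinite forms\<close>

lemma cinner_sum_right: "cinner x (\<Sum>i\<in>I. f i) = (\<Sum>i\<in>I. cinner x (f i))"
  unfolding cinner_def by (subst sum.swap) (simp add: sum_distrib_left)

lemma cinner_sum_left: "cinner (\<Sum>i\<in>I. f i) x = (\<Sum>i\<in>I. cinner (f i) x)"
  unfolding cinner_def by (subst sum.swap) (simp add: sum_distrib_right)

lemma cinner_scale_right: "cinner x (c *s y) = c * cinner x y"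
  by (simp add: cinner_def sum_distrib_left algebra_simps)

lemma cinner_scale_left: "cinner (c *s x) y = cnj c * cinner x y"
  by (simp add: cinner_def sum_distrib_left algebra_simps)

lemma cinner_diff_right: "cinner x (y - z) = cinner x y - cinner x z"
  by (simp add: cinner_def sum_subtractf algebra_simps)

lemma cinner_diff_left: "cinner (x - y) z = cinner x z - cinner y z"
  by (simp add: cinner_def sum_subtractf algebra_simps)

lemma cinner_commute: "cinner x y = cnj (cinner y x)"
  by (simp add: cinner_def mult.commute)

lemma matrix_vector_mult_sum: "A *v (\<Sum>i\<in>I. f i) = (\<Sum>i\<in>I. A *v f i)"
  for A :: "complex ^ 'n ^ 'm"
  by (induction I rule: infinite_finite_induct) (auto simp: matrix_vector_right_distrib)

lemma sum_matrix_vector_mult: "(\<Sum>i\<in>I. B i) *v x = (\<Sum>i\<in>I. B i *v x)"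
  for x :: "complex ^ 'n"
  by (induction I rule: infinite_finite_induct) (auto simp: matrix_vector_mult_add_rdistrib)

lemma psd_form_commute:
  assumes "positive_semidefinite A"
  shows "cinner x (A *v y) = cnj (cinner y (A *v x))"
proof -
  have h: "A $ i $ j = cnj (A $ j $ i)" for i j
    using assms unfolding positive_semidefinite_def by blast
  have "cinner x (A *v y) = (\<Sum>i\<in>UNIV. \<Sum>j\<in>UNIV. cnj (x $ i) * (A $ i $ j * y $ j))"
    by (simp add: cinner_def matrix_vector_mult_def sum_distrib_left)
  also have "\<dots> = (\<Sum>j\<in>UNIV. \<Sum>i\<in>UNIV. cnj (x $ i) * (cnj (A $ j $ i) * y $ j))"
    by (subst sum.swap) (simp only: h[symmetric])
  also have "\<dots> = cnj (cinner y (A *v x))"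
    by (simp add: cinner_def matrix_vector_mult_def sum_distrib_left algebra_simps)
  finally show ?thesis .
qed

lemma psd_form_nonneg:
  assumes "positive_semidefinite A"
  shows "0 \<le> Re (cinner x (A *v x))"
  using assms by (simp add: positive_semidefinite_def)

lemma psd_form_real:
  assumes "positive_semidefinite A"
  shows "cinner x (A *v x) = of_real (Re (cinner x (A *v x)))"
  using psd_form_commute[OF assms, of x x]
  by (metis Reals_cnj_iff of_real_Re)

lemma psd_form_expand:
  assumes "positive_semidefinite A"
  shows "Re (cinner (x - c *s y) (A *v (x - c *s y))) =
    Re (cinner x (A *v x)) - 2 * Re (c * cinner x (A *v y)) + (cmod c)\<^sup>2 * Re (cinner y (A *v y))"
proof -
  have "cinner (x - c *s y) (A *v (x - c *s y)) =
      cinner x (A *v x) - c * cinner x (A *v y) - cnj (c * cinner x (A *v y))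
      + (c * cnj c) * cinner y (A *v y)"
    by (simp add: matrix_vector_mult_diff_distrib cinner_diff_left cinner_diff_right
        vector_scalar_commute cinner_scale_left cinner_scale_right
        psd_form_commute[OF assms, of y x] algebra_simps)
  moreover have "Re ((c * cnj c) * cinner y (A *v y)) = (cmod c)\<^sup>2 * Re (cinner y (A *v y))"
    by (simp add: complex_mult_cnj cmod_power2)
  ultimately show ?thesis by simp
qed

lemma form_scale:
  "Re (cinner (c *s x) (A *v (c *s x))) = (cmod c)\<^sup>2 * Re (cinner x (A *v x))"
proof -
  have "cinner (c *s x) (A *v (c *s x)) = of_real ((cmod c)\<^sup>2) * cinner x (A *v x)"
    unfolding complex_norm_square
    by (simp add: vector_scalar_commute cinner_scale_left cinner_scale_right)
  then show ?thesis by simp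
qed

text \<open>The form is nonnegative at x - c y for every c. Since it may be degenerate, a null
  vector y is treated separately.\<close>

lemma psd_form_Cauchy_Schwarz:
  assumes "positive_semidefinite A"
  shows "cmod (cinner x (A *v y)) \<le> sqrt (Re (cinner x (A *v x))) * sqrt (Re (cinner y (A *v y)))"
proof -
  define X Y z where "X = Re (cinner x (A *v x))" and "Y = Re (cinner y (A *v y))"
    and "z = cinner x (A *v y)"
  have XY: "X \<ge> 0" "Y \<ge> 0" using psd_form_nonneg[OF assms] by (auto simp: X_def Y_def)
  \<comment> \<open>Taking c = t * cnj z removes the phase of z and leaves a real quadratic in
    t.\<close>
  have ineq: "0 \<le> X - 2 * (t * (cmod z)\<^sup>2) + t\<^sup>2 * (cmod z)\<^sup>2 * Y" for t :: real
  proof -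
    have "Re (of_real t * cnj z * z) = t * (cmod z)\<^sup>2"
      by (simp add: cmod_power2) (simp add: power2_eq_square algebra_simps)
    then show ?thesis
      using psd_form_nonneg[OF assms, of "x - (of_real t * cnj z) *s y"]
      unfolding psd_form_expand[OF assms] X_def[symmetric] Y_def[symmetric] z_def[symmetric]
      by (simp add: norm_mult power_mult_distrib)
  qed
  have "(cmod z)\<^sup>2 \<le> X * Y"
  proof (cases "Y = 0")
    case True
    have "(cmod z)\<^sup>2 = 0"
    proof (rule ccontr)
      assume "(cmod z)\<^sup>2 \<noteq> 0"
      \<comment> \<open>With Y = 0 the quadratic is linear in t; this t gives it the value
        -1.\<close>
      then have "((X + 1) / (2 * (cmod z)\<^sup>2)) * (cmod z)\<^sup>2 = (X + 1) / 2" by simp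
      then show False
        using ineq[of "(X + 1) / (2 * (cmod z)\<^sup>2)"] True by simp
    qed
    then show ?thesis using True by simp
  next
    case False
    \<comment> \<open>When z is nonzero, t = 1/Y minimises the quadratic.\<close>
    then have "0 \<le> X - (cmod z)\<^sup>2 / Y"
      using ineq[of "1 / Y"] by (simp add: power2_eq_square)
    then show ?thesis using False XY by (simp add: field_simps)
  qed
  then have "cmod z \<le> sqrt (X * Y)" by (simp add: real_le_rsqrt)
  then show ?thesis by (simp add: real_sqrt_mult X_def Y_def z_def)
qed

section \<open>Resolutions of the identity, outcome probabilities and the overlap kernel\<close>

text \<open>A Parseval frame, that is, a rank-one POVM; the vectors need be neither normalised nor
  orthogonal.\<close>

definition resolution :: "'i set \<Rightarrow> ('i \<Rightarrow> complex ^ 'n) \<Rightarrow> bool" where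
  "resolution I a \<longleftrightarrow> (\<Sum>i\<in>I. ketbra (a i) (a i)) = mat 1"

lemma ketbra_mult_vector: "ketbra x y *v z = cinner y z *s x"
  by (simp add: vec_eq_iff ketbra_def cinner_def matrix_vector_mult_def sum_distrib_left algebra_simps)

lemma resolution_expand:
  assumes "resolution I a"
  shows "(\<Sum>i\<in>I. cinner (a i) x *s a i) = x"
proof -
  have "(\<Sum>i\<in>I. cinner (a i) x *s a i) = (\<Sum>i\<in>I. ketbra (a i) (a i)) *v x"
    by (simp add: ketbra_mult_vector sum_matrix_vector_mult)
  then show ?thesis using assms by (simp add: resolution_def)
qed

lemma resolution_Parseval:
  assumes "resolution I a"
  shows "(\<Sum>i\<in>I. cinner x (a i) * cinner (a i) y) = cinner x y"
  using arg_cong[OF resolution_expand[OF assms, of y], of "cinner x"]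
  by (simp add: cinner_sum_right cinner_scale_right mult.commute)

definition prob :: "complex ^ 'n ^ 'n \<Rightarrow> ('i \<Rightarrow> complex ^ 'n) \<Rightarrow> 'i \<Rightarrow> real" where
  "prob \<rho> a i = Re (cinner (a i) (\<rho> *v a i))"

text \<open>The Kirkwood-Dirac quasi-distribution of \<open>\<rho>\<close>: complex-valued, but with
  the two outcome distributions as marginals when \<open>a\<close> and \<open>b\<close> resolve the
  identity.\<close>

definition overlap_kernel ::
  "complex ^ 'n ^ 'n \<Rightarrow> ('i \<Rightarrow> complex ^ 'n) \<Rightarrow> ('j \<Rightarrow> complex ^ 'n) \<Rightarrow> 'i \<Rightarrow> 'j \<Rightarrow> complex" where
  "overlap_kernel \<rho> a b i j = cinner (b j) (a i) * cinner (a i) (\<rho> *v b j)"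

text \<open>Each term is the trace of \<open>\<rho>\<close> times a ketbra, and the ketbras add up
  to the identity.\<close>

lemma sum_prob:
  assumes "resolution I a" "density_matrix \<rho>"
  shows "(\<Sum>i\<in>I. prob \<rho> a i) = 1"
proof -
  have "(\<Sum>i\<in>I. cinner (a i) (\<rho> *v a i)) =
    (\<Sum>i\<in>I. \<Sum>k\<in>UNIV. \<Sum>l\<in>UNIV. \<rho> $ k $ l * ketbra (a i) (a i) $ l $ k)"
    by (simp add: cinner_def matrix_vector_mult_def ketbra_def sum_distrib_left algebra_simps)
  also have "\<dots> = (\<Sum>k\<in>UNIV. \<Sum>l\<in>UNIV. \<rho> $ k $ l * (\<Sum>i\<in>I. ketbra (a i) (a i)) $ l $ k)"
    unfolding sum_component sum_distrib_left
    by (subst sum.swap, rule sum.cong[OF refl], rule sum.swap)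
  also have "\<dots> = trace \<rho>"
    using assms(1) by (simp add: resolution_def mat_def trace_def if_distrib cong: if_cong)
  finally have "(\<Sum>i\<in>I. cinner (a i) (\<rho> *v a i)) = 1"
    using assms(2) by (simp add: density_matrix_def)
  then show ?thesis
    using Re_sum[of "\<lambda>i. cinner (a i) (\<rho> *v a i)" I] by (simp add: prob_def)
qed

lemma sum_kernel:
  assumes "resolution I a" "positive_semidefinite \<rho>"
  shows "(\<Sum>i\<in>I. overlap_kernel \<rho> a b i j) = of_real (prob \<rho> b j)"
  unfolding overlap_kernel_def prob_def resolution_Parseval[OF assms(1)]
  by (rule psd_form_real[OF assms(2)])

text \<open>One factor of the kernel is an overlap; the other is controlled by Cauchy-Schwarz for
  the form of \<open>\<rho>\<close>.\<close>

lemma norm_kernel_le: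
  assumes "positive_semidefinite \<rho>" "cmod (cinner (a i) (b j)) \<le> c"
  shows "cmod (overlap_kernel \<rho> a b i j) \<le> c * sqrt (prob \<rho> a i) * sqrt (prob \<rho> b j)"
proof -
  have "cmod (cinner (b j) (a i)) \<le> c" using assms(2) by (subst cinner_commute) simp
  then have "cmod (overlap_kernel \<rho> a b i j) \<le> c * (sqrt (prob \<rho> a i) * sqrt (prob \<rho> b j))"
    unfolding overlap_kernel_def norm_mult prob_def
    by (intro mult_mono psd_form_Cauchy_Schwarz[OF assms(1)]) (auto intro: order_trans[OF norm_ge_zero])
  then show ?thesis by (simp add: mult.assoc)
qed

text \<open>Cauchy-Schwarz twice: for the form at each index, then for the sum over the
  indices.\<close>

lemma sum_form_le:
  assumes "positive_semidefinite \<rho>"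
  shows "cmod (\<Sum>i\<in>I. cinner (x i) (\<rho> *v y i)) \<le>
    sqrt (\<Sum>i\<in>I. Re (cinner (x i) (\<rho> *v x i))) * sqrt (\<Sum>i\<in>I. Re (cinner (y i) (\<rho> *v y i)))"
proof -
  let ?X = "\<lambda>i. Re (cinner (x i) (\<rho> *v x i))" and ?Y = "\<lambda>i. Re (cinner (y i) (\<rho> *v y i))"
  note nn = psd_form_nonneg[OF assms]
  have "cmod (\<Sum>i\<in>I. cinner (x i) (\<rho> *v y i)) \<le> (\<Sum>i\<in>I. sqrt (?X i) * sqrt (?Y i))"
    by (intro order_trans[OF norm_sum] sum_mono psd_form_Cauchy_Schwarz assms)
  also have "\<dots> \<le> sqrt ((\<Sum>i\<in>I. ?X i) * (\<Sum>i\<in>I. ?Y i))"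
    using Cauchy_Schwarz_ineq_sum[of "\<lambda>i. sqrt (?X i)" "\<lambda>i. sqrt (?Y i)" I] nn
    by (intro real_le_rsqrt) simp
  finally show ?thesis by (simp add: real_sqrt_mult)
qed

section \<open>The L^2 bound for the kernel\<close>

text \<open>The operator V with V = sum of v_j |b_j><b_j|, applied to \<open>x\<close>.\<close>

definition weighted :: "'j set \<Rightarrow> ('j \<Rightarrow> complex ^ 'n) \<Rightarrow> ('j \<Rightarrow> complex) \<Rightarrow> complex ^ 'n \<Rightarrow> complex ^ 'n" where
  "weighted J b v x = (\<Sum>j\<in>J. (v j * cinner (b j) x) *s b j)"

lemma form_weighted_right:
  "cinner x (\<rho> *v weighted J b v y) = (\<Sum>j\<in>J. v j * cinner (b j) y * cinner x (\<rho> *v b j))"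
  by (simp add: weighted_def matrix_vector_mult_sum cinner_sum_right vector_scalar_commute
      cinner_scale_right)

lemma form_weighted_left:
  "cinner (weighted J b v x) (\<rho> *v y) = (\<Sum>j\<in>J. cnj (v j) * cinner x (b j) * cinner (b j) (\<rho> *v y))"
  by (simp add: weighted_def cinner_sum_left cinner_scale_left cinner_commute[of x])

text \<open>The left-hand side is the trace of V* \<rho> V. After expansion \<open>a\<close> occurs
  only in the sum of <b_k|a_i><a_i|b_j> over i, which Parseval turns into <b_k|b_j>.\<close>

lemma sum_form_weighted:
  assumes "resolution I a"
  shows "(\<Sum>i\<in>I. cinner (weighted J b v (a i)) (\<rho> *v weighted J b v (a i))) =
    (\<Sum>j\<in>J. cnj (v j) * cinner (b j) (\<rho> *v weighted J b v (b j)))"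
proof -
  have "(\<Sum>i\<in>I. cinner (weighted J b v (a i)) (\<rho> *v weighted J b v (a i))) =
    (\<Sum>i\<in>I. \<Sum>j\<in>J. \<Sum>k\<in>J. cnj (v j) * v k * cinner (b j) (\<rho> *v b k)
       * (cinner (b k) (a i) * cinner (a i) (b j)))"
    by (simp only: form_weighted_left) (simp add: form_weighted_right sum_distrib_left mult_ac)
  also have "\<dots> = (\<Sum>j\<in>J. \<Sum>k\<in>J. cnj (v j) * v k * cinner (b j) (\<rho> *v b k)
       * (\<Sum>i\<in>I. cinner (b k) (a i) * cinner (a i) (b j)))"
    unfolding sum_distrib_left by (subst sum.swap, rule sum.cong[OF refl], rule sum.swap)
  also have "\<dots> = (\<Sum>j\<in>J. cnj (v j) * cinner (b j) (\<rho> *v weighted J b v (b j)))"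
    unfolding resolution_Parseval[OF assms]
    by (simp add: form_weighted_right sum_distrib_left mult_ac)
  finally show ?thesis .
qed

text \<open>The left-hand side does not depend on the resolution \<open>a\<close>; evaluating it with \<open>a = b\<close> and
  applying Cauchy--Schwarz bounds it by the geometric mean of itself and the right-hand side.\<close>

lemma sum_form_weighted_le:
  assumes "resolution I a" "resolution J b" "positive_semidefinite \<rho>"
  shows "(\<Sum>i\<in>I. Re (cinner (weighted J b v (a i)) (\<rho> *v weighted J b v (a i)))) \<le>
    (\<Sum>j\<in>J. (cmod (v j))\<^sup>2 * prob \<rho> b j)"
proof -
  define Z where "Z = (\<Sum>i\<in>I. Re (cinner (weighted J b v (a i)) (\<rho> *v weighted J b v (a i))))"
  define W where "W = (\<Sum>j\<in>J. (cmod (v j))\<^sup>2 * prob \<rho> b j)"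
  have nn: "Z \<ge> 0" "W \<ge> 0"
    unfolding Z_def W_def prob_def
    by (intro sum_nonneg mult_nonneg_nonneg psd_form_nonneg[OF assms(3)] zero_le_power2)+
  have Zb: "Z = (\<Sum>j\<in>J. Re (cinner (weighted J b v (b j)) (\<rho> *v weighted J b v (b j))))"
    unfolding Z_def Re_sum[symmetric] sum_form_weighted[OF assms(1)] sum_form_weighted[OF assms(2)] ..
  have "Z \<le> cmod (\<Sum>j\<in>J. cinner (v j *s b j) (\<rho> *v weighted J b v (b j)))"
    unfolding Z_def Re_sum[symmetric] sum_form_weighted[OF assms(1)]
    unfolding cinner_scale_left by (rule complex_Re_le_cmod)
  also have "\<dots> \<le> sqrt (\<Sum>j\<in>J. Re (cinner (v j *s b j) (\<rho> *v (v j *s b j)))) * sqrt Z"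
    unfolding Zb by (rule sum_form_le[OF assms(3)])
  also have "(\<Sum>j\<in>J. Re (cinner (v j *s b j) (\<rho> *v (v j *s b j)))) = W"
    unfolding W_def prob_def
    by (simp add: form_scale)
  finally have "sqrt Z * sqrt Z \<le> sqrt W * sqrt Z" using nn by simp
  then have "Z \<le> W"
    using nn mult_right_le_imp_le[of "sqrt Z" "sqrt Z" "sqrt W"] by (cases "Z = 0") auto
  then show ?thesis by (simp add: Z_def W_def)
qed

text \<open>Summing over j first turns the kernel into the operator V, leaving one form value per i.
  In the Cauchy-Schwarz bound the first factor is exact and \<open>sum_form_weighted_le\<close>
  controls the second.\<close>

lemma kernel_L2_bound:
  assumes "resolution I a" "resolution J b" "positive_semidefinite \<rho>"
  shows "cmod (\<Sum>i\<in>I. \<Sum>j\<in>J. w i * v j * overlap_kernel \<rho> a b i j) \<le>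
    sqrt (\<Sum>i\<in>I. (cmod (w i))\<^sup>2 * prob \<rho> a i) * sqrt (\<Sum>j\<in>J. (cmod (v j))\<^sup>2 * prob \<rho> b j)"
proof -
  have "(\<Sum>i\<in>I. \<Sum>j\<in>J. w i * v j * overlap_kernel \<rho> a b i j) =
      (\<Sum>i\<in>I. cinner (cnj (w i) *s a i) (\<rho> *v weighted J b v (a i)))"
    by (simp add: cinner_scale_left form_weighted_right overlap_kernel_def sum_distrib_left algebra_simps)
  also have "cmod \<dots> \<le> sqrt (\<Sum>i\<in>I. Re (cinner (cnj (w i) *s a i) (\<rho> *v (cnj (w i) *s a i)))) *
      sqrt (\<Sum>i\<in>I. Re (cinner (weighted J b v (a i)) (\<rho> *v weighted J b v (a i))))"
    by (rule sum_form_le[OF assms(3)])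
  also have "(\<Sum>i\<in>I. Re (cinner (cnj (w i) *s a i) (\<rho> *v (cnj (w i) *s a i)))) =
      (\<Sum>i\<in>I. (cmod (w i))\<^sup>2 * prob \<rho> a i)"
    by (simp add: prob_def form_scale)
  finally show ?thesis
    using sum_form_weighted_le[OF assms, of v]
    by (elim order_trans)
      (auto intro!: mult_left_mono sum_nonneg mult_nonneg_nonneg psd_form_nonneg[OF assms(3)] simp: prob_def)
qed

section \<open>Stein interpolation\<close>

text \<open>A crude bound uniform in the exponent; it supplies the boundedness on the strip that the
  three lines theorem asks for.\<close>

lemma powr_le_endpoints:
  fixes x :: real
  assumes "a \<le> t" "t \<le> b" "0 \<le> x"
  shows "x powr t \<le> x powr a + x powr b"
proof (cases "x \<ge> 1")
  case True
  then have "x powr t \<le> x powr b" using assms by (intro powr_mono)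
  then show ?thesis by (simp add: add_increasing)
next
  case False
  then have "x powr t \<le> x powr a" using assms by (intro powr_mono') auto
  then show ?thesis by (simp add: add_increasing2)
qed

text \<open>With \<open>w\<^sub>i = p\<^sub>i\<^bsup>s(z)\<^esup>\<close> and \<open>v\<^sub>j = q\<^sub>j\<^bsup>t(z)\<^esup>\<close> for affine \<open>s\<close>, \<open>t\<close>, the form
  \<open>\<Sum> w\<^sub>i v\<^sub>j K\<^sub>i\<^sub>j\<close> is bounded by \<open>sqrt (P Q)\<close> on \<open>Re z = 0\<close>, by \<open>c P Q\<close> on \<open>Re z = 1\<close>, and equals
  \<open>Q\<close> at \<open>z = 1 - 1/\<alpha>\<close>, where \<open>P\<close>, \<open>Q\<close> are the two power sums.\<close>

lemma kernel_interpolation: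
  fixes K :: "'i \<Rightarrow> 'j \<Rightarrow> complex"
  assumes nn: "\<And>i. 0 \<le> p i" "\<And>j. 0 \<le> q j"
    and L2: "\<And>w v. cmod (\<Sum>i\<in>I. \<Sum>j\<in>J. w i * v j * K i j) \<le>
      sqrt (\<Sum>i\<in>I. (cmod (w i))\<^sup>2 * p i) * sqrt (\<Sum>j\<in>J. (cmod (v j))\<^sup>2 * q j)"
    and L1: "\<And>i j. i \<in> I \<Longrightarrow> j \<in> J \<Longrightarrow> cmod (K i j) \<le> c * sqrt (p i) * sqrt (q j)"
    and marginal: "\<And>j. (\<Sum>i\<in>I. K i j) = of_real (q j)"
    and pos: "c > 0" "(\<Sum>i\<in>I. p i powr \<beta>) > 0" "(\<Sum>j\<in>J. q j powr \<alpha>) > 0"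
    and \<alpha>\<beta>: "\<alpha> > 1" "\<beta> > 0" "1 / \<alpha> + 1 / \<beta> = 2"
  shows "ln (\<Sum>j\<in>J. q j powr \<alpha>) \<le> 2 * (\<alpha> - 1) * ln c + \<alpha> / \<beta> * ln (\<Sum>i\<in>I. p i powr \<beta>)"
proof -
  define P Q where "P = (\<Sum>i\<in>I. p i powr \<beta>)" and "Q = (\<Sum>j\<in>J. q j powr \<alpha>)"
  have PQ: "P > 0" "Q > 0" using pos by (auto simp: P_def Q_def)
  \<comment> \<open>The real parts are (r - 1)/2 on the left edge and r - 1/2 on the right, with r =
    \<beta> or \<alpha>. So |w|^2 p on the left and |w| sqrt p on the right both equal p^\<beta>,
    and likewise for v, q and \<alpha>.\<close>
  define s t where "s z = of_real ((\<beta> - 1) / 2) + z * of_real (\<beta> / 2)"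
    and "t z = of_real ((\<alpha> - 1) / 2) + z * of_real (\<alpha> / 2)" for z :: complex
  define w v where "w z i = of_real (p i) powr s z" and "v z j = of_real (q j) powr t z" for z i j
  define F where "F z = (\<Sum>i\<in>I. \<Sum>j\<in>J. w z i * v z j * K i j)" for z
  have norm_w: "cmod (w z i) = p i powr ((\<beta> - 1) / 2 + Re z * (\<beta> / 2))" for z i
    using nn by (simp add: w_def s_def norm_powr_real_powr)
  have norm_v: "cmod (v z j) = q j powr ((\<alpha> - 1) / 2 + Re z * (\<alpha> / 2))" for z j
    using nn by (simp add: v_def t_def norm_powr_real_powr)
  have hol: "F holomorphic_on UNIV"
    unfolding F_def w_def v_def s_def t_def by (intro holomorphic_intros)
  have square_powr: "(x powr ((r - 1) / 2))\<^sup>2 * x = x powr r" if "x \<ge> 0" for x r :: real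
    using that powr_mult_base[of x "r - 1"] by (simp add: power2_eq_square mult.commute flip: powr_add)
  have sqrt_powr: "x powr ((r - 1) / 2 + r / 2) * sqrt x = x powr r" if "x \<ge> 0" for x r :: real
    using that by (simp add: powr_half_sqrt[symmetric] add_divide_distrib diff_divide_distrib flip: powr_add)
  have left: "cmod (F z) \<le> sqrt (P * Q)" if "Re z = 0" for z
    using L2[of "w z" "v z"] that nn
    by (simp add: F_def norm_w norm_v square_powr P_def Q_def real_sqrt_mult)
  have norm_F: "cmod (F z) \<le> (\<Sum>i\<in>I. \<Sum>j\<in>J. cmod (w z i) * cmod (v z j) * cmod (K i j))" for z
    unfolding F_def by (intro order_trans[OF norm_sum] sum_mono) (simp add: norm_mult)
  have right: "cmod (F z) \<le> c * (P * Q)" if "Re z = 1" for z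
  proof -
    note norm_F
    also have "(\<Sum>i\<in>I. \<Sum>j\<in>J. cmod (w z i) * cmod (v z j) * cmod (K i j)) \<le>
        (\<Sum>i\<in>I. \<Sum>j\<in>J. cmod (w z i) * cmod (v z j) * (c * sqrt (p i) * sqrt (q j)))"
      by (intro sum_mono mult_left_mono L1) auto
    also have "\<dots> = (\<Sum>i\<in>I. \<Sum>j\<in>J. c * ((cmod (w z i) * sqrt (p i)) * (cmod (v z j) * sqrt (q j))))"
      by (simp add: mult_ac)
    also have "\<dots> = c * (P * Q)"
      using that nn
      by (simp add: norm_w norm_v sqrt_powr P_def Q_def sum_product flip: sum_distrib_left)
    finally show ?thesis .
  qed
  define C where "C = (\<Sum>i\<in>I. \<Sum>j\<in>J. (p i powr ((\<beta> - 1) / 2) + p i powr ((\<beta> - 1) / 2 + \<beta> / 2)) *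
      (q j powr ((\<alpha> - 1) / 2) + q j powr ((\<alpha> - 1) / 2 + \<alpha> / 2)) * cmod (K i j))"
  have bnd: "cmod (F z) \<le> C" if "0 \<le> Re z" "Re z \<le> 1" for z
  proof -
    have "Re z * (\<beta> / 2) \<le> \<beta> / 2" "Re z * (\<alpha> / 2) \<le> \<alpha> / 2"
      using that \<alpha>\<beta> by (auto intro: mult_left_le_one_le)
    then show ?thesis
      unfolding C_def using that \<alpha>\<beta> nn
      by (intro order_trans[OF norm_F] sum_mono mult_right_mono mult_mono)
        (auto simp: norm_w norm_v intro!: powr_le_endpoints)
  qed
  \<comment> \<open>The relation between \<alpha> and \<beta> makes this also 1/\<beta> - 1, so the
    weights w become trivial exactly where v has exponent \<alpha> - 1.\<close>
  define \<theta> where "\<theta> = 1 - 1 / \<alpha>"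
  have \<theta>: "0 \<le> \<theta>" "\<theta> \<le> 1" using \<alpha>\<beta> by (auto simp: \<theta>_def)
  have \<theta>\<beta>: "\<theta> = 1 / \<beta> - 1" using \<alpha>\<beta> by (simp add: \<theta>_def)
  have "(\<beta> - 1) / 2 + \<theta> * (\<beta> / 2) = 0"
    using \<alpha>\<beta> unfolding \<theta>\<beta> by (simp add: field_simps)
  then have s\<theta>: "s (of_real \<theta>) = 0"
    unfolding s_def of_real_mult[symmetric] of_real_add[symmetric] by simp
  have "(\<alpha> - 1) / 2 + \<theta> * (\<alpha> / 2) = \<alpha> - 1"
    using \<alpha>\<beta> unfolding \<theta>_def by (simp add: field_simps)
  then have t\<theta>: "t (of_real \<theta>) = of_real (\<alpha> - 1)"
    unfolding t_def of_real_mult[symmetric] of_real_add[symmetric] by simp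
  \<comment> \<open>Since 0 powr 0 = 0, the weight is 0 instead of 1 where p i = 0; there
    \<open>L1\<close> forces K i j = 0, so the product is unaffected.\<close>
  have K0: "w (of_real \<theta>) i * v z j * K i j = v z j * K i j" if "i \<in> I" "j \<in> J" for i j z
    using L1[OF that] by (cases "p i = 0") (auto simp: w_def s\<theta>)
  have "F (of_real \<theta>) = (\<Sum>i\<in>I. \<Sum>j\<in>J. v (of_real \<theta>) j * K i j)"
    unfolding F_def by (intro sum.cong refl K0)
  also have "\<dots> = (\<Sum>j\<in>J. v (of_real \<theta>) j * of_real (q j))"
    by (subst sum.swap) (simp add: marginal flip: sum_distrib_left)
  also have "\<dots> = of_real Q"
    unfolding Q_def of_real_sum
  proof (intro sum.cong refl)
    fix j
    have "v (of_real \<theta>) j * of_real (q j) = of_real (q j powr (\<alpha> - 1) * q j)"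
      unfolding v_def t\<theta> using nn by (simp only: powr_of_real of_real_mult)
    then show "v (of_real \<theta>) j * of_real (q j) = of_real (q j powr \<alpha>)"
      using powr_mult_base[of "q j" "\<alpha> - 1"] nn by (simp add: mult.commute)
  qed
  finally have "Q \<le> sqrt (P * Q) powr (1 - \<theta>) * (c * (P * Q)) powr \<theta>"
    using three_lines[OF hol bnd left right, of "of_real \<theta>"] \<theta> PQ \<open>c > 0\<close> by simp
  then have "ln Q \<le> ln (sqrt (P * Q) powr (1 - \<theta>) * (c * (P * Q)) powr \<theta>)"
    using PQ by (intro ln_mono) auto
  also have "\<dots> = (1 - \<theta>) * ((ln P + ln Q) / 2) + \<theta> * (ln c + (ln P + ln Q))"
    using PQ \<open>c > 0\<close> by (simp add: ln_mult ln_powr ln_sqrt)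
  \<comment> \<open>On the right ln Q has the coefficient (1 + \<theta>)/2 < 1, so it is absorbed
    into the left; what remains there is 1/(2 \<alpha>).\<close>
  finally have "ln Q * (1 - (1 + \<theta>) / 2) \<le> \<theta> * ln c + (1 + \<theta>) / 2 * ln P"
    by (simp add: field_simps)
  moreover have "1 - (1 + \<theta>) / 2 = 1 / (2 * \<alpha>)"
    using \<alpha>\<beta> by (simp add: \<theta>_def field_simps)
  moreover have "(1 + \<theta>) / 2 = 1 / (2 * \<beta>)"
    by (simp add: \<theta>\<beta>)
  ultimately have "ln Q * (1 / (2 * \<alpha>)) \<le> \<theta> * ln c + 1 / (2 * \<beta>) * ln P"
    by metis
  then have "ln Q * (1 / (2 * \<alpha>)) * (2 * \<alpha>) \<le> (\<theta> * ln c + 1 / (2 * \<beta>) * ln P) * (2 * \<alpha>)"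
    using \<alpha>\<beta> by (intro mult_right_mono) auto
  moreover have "\<theta> * \<alpha> = \<alpha> - 1" using \<alpha>\<beta> by (simp add: \<theta>_def field_simps)
  moreover have "(\<theta> * ln c + 1 / (2 * \<beta>) * ln P) * (2 * \<alpha>) = 2 * (\<theta> * \<alpha>) * ln c + \<alpha> / \<beta> * ln P"
    by (simp add: field_simps)
  ultimately show ?thesis
    using \<alpha>\<beta> by (simp add: P_def Q_def)
qed

section \<open>The power sum inequality for two measurements\<close>

lemma prob_nonneg: "positive_semidefinite \<rho> \<Longrightarrow> 0 \<le> prob \<rho> a i"
  by (simp add: prob_def psd_form_nonneg)

text \<open>Otherwise the whole kernel vanishes, hence so do its marginals, which cannot be since
  the probabilities sum to 1. This makes ln c and the powers of c meaningful.\<close>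

lemma overlap_bound_pos:
  fixes a :: "'i \<Rightarrow> complex ^ 'n" and b :: "'j \<Rightarrow> complex ^ 'n" and \<rho> :: "complex ^ 'n ^ 'n"
  assumes "resolution I a" "resolution J b" "density_matrix \<rho>"
    and c: "\<And>i j. i \<in> I \<Longrightarrow> j \<in> J \<Longrightarrow> cmod (cinner (a i) (b j)) \<le> c"
  shows "c > 0"
proof (rule ccontr)
  assume "\<not> c > 0"
  have psd: "positive_semidefinite \<rho>" using assms(3) by (simp add: density_matrix_def)
  have "prob \<rho> b j = 0" if "j \<in> J" for j
  proof -
    have "overlap_kernel \<rho> a b i j = 0" if "i \<in> I" for i
    proof -
      have "cmod (overlap_kernel \<rho> a b i j) \<le> c * (sqrt (prob \<rho> a i) * sqrt (prob \<rho> b j))"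
        using norm_kernel_le[of \<rho> a i b j c, OF psd c[OF \<open>i \<in> I\<close> \<open>j \<in> J\<close>]] by (simp add: mult.assoc)
      also have "\<dots> \<le> 0"
        using \<open>\<not> c > 0\<close> by (intro mult_nonpos_nonneg mult_nonneg_nonneg) (auto simp: prob_nonneg[OF psd])
      finally show ?thesis by simp
    qed
    then show ?thesis using sum_kernel[OF assms(1) psd, of b j] by simp
  qed
  then show False using sum_prob[OF assms(2,3)] by simp
qed

lemma sum_powr_pos:
  fixes p :: "'i \<Rightarrow> real"
  assumes "finite I" "sum p I = 1" "\<And>i. 0 \<le> p i"
  shows "0 < (\<Sum>i\<in>I. p i powr r)"
proof -
  obtain i where "i \<in> I" "p i \<noteq> 0" using assms(2) by (metis sum.neutral zero_neq_one)
  then show ?thesis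
    using assms by (intro sum_pos2[of _ i]) auto
qed

lemma power_sum_inequality:
  fixes a :: "'i \<Rightarrow> complex ^ 'n" and b :: "'j \<Rightarrow> complex ^ 'n" and \<rho> :: "complex ^ 'n ^ 'n"
  assumes "finite I" "finite J" "resolution I a" "resolution J b" "density_matrix \<rho>"
    and c: "\<And>i j. i \<in> I \<Longrightarrow> j \<in> J \<Longrightarrow> cmod (cinner (a i) (b j)) \<le> c"
    and \<alpha>\<beta>: "\<alpha> > 1" "\<beta> > 0" "1 / \<alpha> + 1 / \<beta> = 2"
  shows "ln (\<Sum>j\<in>J. prob \<rho> b j powr \<alpha>) \<le> 2 * (\<alpha> - 1) * ln c + \<alpha> / \<beta> * ln (\<Sum>i\<in>I. prob \<rho> a i powr \<beta>)"
proof -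
  have psd: "positive_semidefinite \<rho>" using assms(5) by (simp add: density_matrix_def)
  show ?thesis
    by (rule kernel_interpolation[where K = "overlap_kernel \<rho> a b"])
      (use assms psd in \<open>auto intro!: prob_nonneg kernel_L2_bound norm_kernel_le sum_kernel
         overlap_bound_pos[of I a J b \<rho> c] sum_powr_pos sum_prob\<close>)
qed

section \<open>The Renyi bound and its Shannon limit\<close>

lemma sum_powr_support:
  fixes p :: "'i \<Rightarrow> real"
  assumes "finite I" "\<And>i. 0 \<le> p i"
  shows "(\<Sum>i\<in>{i\<in>I. p i > 0}. p i powr r) = (\<Sum>i\<in>I. p i powr r)"
  using assms by (intro sum.mono_neutral_left) (auto simp: order_less_le)

text \<open>Off r = 1 the Renyi entropy is minus the difference quotient at 1 of the logarithm of
  the power sum, whose derivative there is the sum of p ln p.\<close>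

lemma renyi_entropy_tendsto_shannon:
  fixes p :: "'i \<Rightarrow> real"
  assumes "finite I" "sum p I = 1" "\<And>i. 0 \<le> p i"
  shows "((\<lambda>r. renyi_entropy r I p) \<longlongrightarrow> shannon_entropy I p) (at 1)"
proof -
  define S where "S = {i\<in>I. p i > 0}"
  have one: "(\<Sum>i\<in>S. p i powr 1) = 1"
    unfolding S_def sum_powr_support[OF assms(1,3)] using assms by simp
  have "((\<lambda>r. \<Sum>i\<in>S. p i powr r) has_real_derivative (\<Sum>i\<in>S. p i * ln (p i))) (at 1)"
    by (intro DERIV_sum) (auto intro!: derivative_eq_intros simp: S_def)
  then have "((\<lambda>r. ln (\<Sum>i\<in>S. p i powr r)) has_real_derivative 1 / 1 * (\<Sum>i\<in>S. p i * ln (p i))) (at 1)"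
    by (rule DERIV_chain2[rotated]) (unfold one, rule DERIV_ln_divide, simp)
  then have "((\<lambda>r. ln (\<Sum>i\<in>S. p i powr r)) has_real_derivative (\<Sum>i\<in>S. p i * ln (p i))) (at 1)"
    by simp
  then have "((\<lambda>r. (ln (\<Sum>i\<in>S. p i powr r) - ln 1) / (r - 1)) \<longlongrightarrow> (\<Sum>i\<in>S. p i * ln (p i))) (at 1)"
    unfolding has_field_derivative_iff one .
  then have "((\<lambda>r. - (ln (\<Sum>i\<in>S. p i powr r) / (r - 1))) \<longlongrightarrow> shannon_entropy I p) (at 1)"
    unfolding shannon_entropy_def S_def[symmetric] by (intro tendsto_minus) simp
  then show ?thesis
  proof (rule Lim_transform_eventually)
    show "eventually (\<lambda>r. - (ln (\<Sum>i\<in>S. p i powr r) / (r - 1)) = renyi_entropy r I p) (at 1)"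
      using eventually_neq_at_within[of 1 1 UNIV]
      by eventually_elim (simp add: renyi_entropy_def S_def[symmetric] divide_simps algebra_simps)
  qed
qed

text \<open>Solving for \<beta> gives \<beta> = \<alpha>/(2 \<alpha> - 1). The second identity
  matches the exponent in the power sum inequality with the prefactors of the two entropies.\<close>

lemma conjugate_exponents:
  fixes \<alpha> \<beta> :: real
  assumes "\<alpha> > 1" "\<beta> > 0" "1 / \<alpha> + 1 / \<beta> = 2"
  shows "\<beta> < 1" "\<alpha> / \<beta> = (\<alpha> - 1) / (1 - \<beta>)"
proof -
  have "1 / \<beta> = (2 * \<alpha> - 1) / \<alpha>"
    using assms by (simp add: diff_divide_distrib)
  then have \<beta>: "\<beta> = \<alpha> / (2 * \<alpha> - 1)"
    by (metis div_by_1 divide_divide_eq_right mult_1)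
  have "1 - \<beta> = (\<alpha> - 1) / (2 * \<alpha> - 1)" "\<alpha> / \<beta> = 2 * \<alpha> - 1"
    using \<open>\<alpha> > 1\<close> unfolding \<beta> by (simp_all add: field_simps)
  then show "\<alpha> / \<beta> = (\<alpha> - 1) / (1 - \<beta>)"
    using \<open>\<alpha> > 1\<close> by simp
  show "\<beta> < 1"
    using \<open>1 - \<beta> = _\<close> \<open>\<alpha> > 1\<close> divide_pos_pos[of "\<alpha> - 1" "2 * \<alpha> - 1"] by linarith
qed

lemma renyi_uncertainty_gt_one:
  fixes a :: "'i \<Rightarrow> complex ^ 'n" and b :: "'j \<Rightarrow> complex ^ 'n" and \<rho> :: "complex ^ 'n ^ 'n"
  assumes "finite I" "finite J" "resolution I a" "resolution J b" "density_matrix \<rho>"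
    and "\<And>i j. i \<in> I \<Longrightarrow> j \<in> J \<Longrightarrow> cmod (cinner (a i) (b j)) \<le> c"
    and \<alpha>\<beta>: "\<alpha> > 1" "\<beta> > 0" "1 / \<alpha> + 1 / \<beta> = 2"
  shows "renyi_entropy \<alpha> J (prob \<rho> b) + renyi_entropy \<beta> I (prob \<rho> a) \<ge> - 2 * ln c"
proof -
  have psd: "positive_semidefinite \<rho>" using assms(5) by (simp add: density_matrix_def)
  have "\<beta> < 1" and "\<alpha> / \<beta> = (\<alpha> - 1) / (1 - \<beta>)"
    using conjugate_exponents[OF \<alpha>\<beta>] by auto
  define X Y where "X = ln (\<Sum>j\<in>J. prob \<rho> b j powr \<alpha>)" and "Y = ln (\<Sum>i\<in>I. prob \<rho> a i powr \<beta>)"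
  have "X \<le> 2 * (\<alpha> - 1) * ln c + \<alpha> / \<beta> * Y"
    using power_sum_inequality[OF assms] by (simp add: X_def Y_def)
  moreover note \<open>\<alpha> / \<beta> = (\<alpha> - 1) / (1 - \<beta>)\<close>
  ultimately have "X / (\<alpha> - 1) \<le> ((\<alpha> - 1) * (2 * ln c + Y / (1 - \<beta>))) / (\<alpha> - 1)"
    using \<alpha>\<beta> by (intro divide_right_mono) (auto simp: algebra_simps)
  also have "\<dots> = 2 * ln c + Y / (1 - \<beta>)"
    using \<alpha>\<beta> by simp
  finally have "- 2 * ln c \<le> X / (1 - \<alpha>) + Y / (1 - \<beta>)"
    using minus_divide_right[of X "\<alpha> - 1"] by simp
  then show ?thesis
    using \<alpha>\<beta> \<open>\<beta> < 1\<close> assms(1,2)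
    by (simp add: renyi_entropy_def sum_powr_support prob_nonneg[OF psd] X_def Y_def)
qed

text \<open>Either exactly one order exceeds 1, and exchanging the measurements if necessary reduces
  to the previous lemma, or both equal 1, a limit case.\<close>

lemma renyi_uncertainty:
  fixes a :: "'i \<Rightarrow> complex ^ 'n" and b :: "'j \<Rightarrow> complex ^ 'n" and \<rho> :: "complex ^ 'n ^ 'n"
  assumes "finite I" "finite J" "resolution I a" "resolution J b" "density_matrix \<rho>"
    and c: "\<And>i j. i \<in> I \<Longrightarrow> j \<in> J \<Longrightarrow> cmod (cinner (a i) (b j)) \<le> c"
    and \<alpha>\<beta>: "\<alpha> > 0" "\<beta> > 0" "1 / \<alpha> + 1 / \<beta> = 2"
  shows "renyi_entropy \<alpha> I (prob \<rho> a) + renyi_entropy \<beta> J (prob \<rho> b) \<ge> - 2 * ln c"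
proof -
  have psd: "positive_semidefinite \<rho>" using assms(5) by (simp add: density_matrix_def)
  have c': "cmod (cinner (b j) (a i)) \<le> c" if "j \<in> J" "i \<in> I" for i j
    using c[OF that(2,1)] by (subst cinner_commute) simp
  consider "\<alpha> > 1" | "\<alpha> < 1" | "\<alpha> = 1" by linarith
  then show ?thesis
  proof cases
    case 1
    then show ?thesis
      using renyi_uncertainty_gt_one[OF assms(2,1,4,3,5) c' _ \<alpha>\<beta>(2,3)] by simp
  next
    case 2
    then have "1 / \<alpha> > 1" using \<alpha>\<beta> by simp
    then have "1 / \<beta> < 1" using \<alpha>\<beta> by linarith
    then have "\<beta> > 1" using \<alpha>\<beta> by simp
    then show ?thesis
      using renyi_uncertainty_gt_one[OF assms(1,2,3,4,5) c _ \<alpha>\<beta>(1)] \<alpha>\<beta>(3) by (simp add: add.commute)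
  next
    case 3
    then have "\<beta> = 1" using \<alpha>\<beta> by simp
    \<comment> \<open>r/(2r - 1) is the order conjugate to r. It tends to 1 without taking the value
      1, so the punctured limit at 1 can be composed with it.\<close>
    have "((\<lambda>r. r / (2 * r - 1)) \<longlongrightarrow> 1 / (2 * 1 - 1)) (at_right (1::real))"
      by (intro tendsto_intros) auto
    moreover have "eventually (\<lambda>r::real. r / (2 * r - 1) \<noteq> 1) (at_right 1)"
      using eventually_at_right_less[of "1::real"] by eventually_elim (simp add: field_simps)
    ultimately have conj: "filterlim (\<lambda>r::real. r / (2 * r - 1)) (at 1) (at_right 1)"
      by (simp add: filterlim_at)
    have "((\<lambda>r. renyi_entropy r I (prob \<rho> a)) \<longlongrightarrow> shannon_entropy I (prob \<rho> a)) (at_right 1)"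
      by (rule filterlim_mono[OF renyi_entropy_tendsto_shannon order_refl at_le])
        (auto simp: assms sum_prob prob_nonneg psd)
    moreover have "((\<lambda>r. renyi_entropy (r / (2 * r - 1)) J (prob \<rho> b)) \<longlongrightarrow>
        shannon_entropy J (prob \<rho> b)) (at_right 1)"
      by (rule filterlim_compose[OF renyi_entropy_tendsto_shannon conj])
        (auto simp: assms sum_prob prob_nonneg psd)
    ultimately have "((\<lambda>r. renyi_entropy r I (prob \<rho> a) + renyi_entropy (r / (2 * r - 1)) J (prob \<rho> b)) \<longlongrightarrow>
        shannon_entropy I (prob \<rho> a) + shannon_entropy J (prob \<rho> b)) (at_right 1)"
      by (rule tendsto_add)
    moreover have "eventually (\<lambda>r. - 2 * ln c \<le>
        renyi_entropy r I (prob \<rho> a) + renyi_entropy (r / (2 * r - 1)) J (prob \<rho> b)) (at_right 1)"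
      using eventually_at_right_less[of "1::real"]
    proof eventually_elim
      case (elim r)
      then show ?case
        by (intro renyi_uncertainty_gt_one[OF assms(2,1,4,3,5) c']) (auto simp: field_simps)
    qed
    ultimately have "- 2 * ln c \<le> shannon_entropy I (prob \<rho> a) + shannon_entropy J (prob \<rho> b)"
      by (rule tendsto_lowerbound) simp
    then show ?thesis using 3 \<open>\<beta> = 1\<close> by (simp add: renyi_entropy_def)
  qed
qed

section \<open>The Tsallis bound\<close>

text \<open>Turns the multiplicative bound into the additive form needed for Tsallis entropies. The
  factor Q <= 1 is dropped, and ln x <= x - 1 is used at x = P^(-g) and at x = P.\<close>

lemma diff_le_of_powr_bound:
  fixes P Q k g :: real
  assumes "0 < Q" "Q \<le> 1" "1 \<le> P" "0 \<le> g" "Q \<le> k * P powr g"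
  shows "Q - k \<le> g * (P - 1)"
proof -
  have "Q * P powr (- g) \<le> k"
    using assms by (simp add: powr_minus field_simps)
  then have "Q - k \<le> Q * (1 - P powr (- g))" by (simp add: algebra_simps)
  also have "\<dots> \<le> 1 - P powr (- g)"
    using assms powr_mono[of "-g" 0 P] by (intro mult_left_le_one_le) auto
  also have "\<dots> \<le> g * ln P"
    using assms ln_le_minus_one[of "P powr (- g)"] by (simp add: ln_powr)
  also have "\<dots> \<le> g * (P - 1)"
    using assms by (intro mult_left_mono ln_le_minus_one) auto
  finally show ?thesis .
qed

lemma tsallis_uncertainty_gt_one:
  fixes a :: "'i \<Rightarrow> complex ^ 'n" and b :: "'j \<Rightarrow> complex ^ 'n" and \<rho> :: "complex ^ 'n ^ 'n"
  assumes "finite I" "finite J" "resolution I a" "resolution J b" "density_matrix \<rho>"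
    and c: "\<And>i j. i \<in> I \<Longrightarrow> j \<in> J \<Longrightarrow> cmod (cinner (a i) (b j)) \<le> c"
    and \<alpha>\<beta>: "\<alpha> > 1" "\<beta> > 0" "1 / \<alpha> + 1 / \<beta> = 2"
  shows "tsallis_entropy \<alpha> J (prob \<rho> b) + tsallis_entropy \<beta> I (prob \<rho> a) \<ge> ln_alpha \<alpha> (c powr (-2))"
proof -
  have psd: "positive_semidefinite \<rho>" using assms(5) by (simp add: density_matrix_def)
  have "\<beta> < 1" and "\<alpha> / \<beta> = (\<alpha> - 1) / (1 - \<beta>)"
    using conjugate_exponents[OF \<alpha>\<beta>] by auto
  note sums = sum_prob[OF assms(3,5)] sum_prob[OF assms(4,5)]
  have prob_le_1: "prob \<rho> a i \<le> 1" if "i \<in> I" for i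
    unfolding sums(1)[symmetric] using that assms(1) by (intro member_le_sum prob_nonneg psd)
  have prob_le_1': "prob \<rho> b j \<le> 1" if "j \<in> J" for j
    unfolding sums(2)[symmetric] using that assms(2) by (intro member_le_sum prob_nonneg psd)
  define P Q where "P = (\<Sum>i\<in>I. prob \<rho> a i powr \<beta>)" and "Q = (\<Sum>j\<in>J. prob \<rho> b j powr \<alpha>)"
  have "c > 0" by (rule overlap_bound_pos[OF assms(3,4,5) c])
  have "Q > 0" "P > 0"
    unfolding P_def Q_def using assms(1,2) sums by (auto intro!: sum_powr_pos prob_nonneg[OF psd])
  \<comment> \<open>On [0,1] a smaller exponent gives a larger power, so comparison with exponent 1
    yields P >= 1 here and Q <= 1 below.\<close>
  have "(\<Sum>i\<in>I. prob \<rho> a i powr 1) \<le> P"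
    unfolding P_def using \<open>\<beta> < 1\<close> by (intro sum_mono powr_mono') (auto simp: prob_nonneg[OF psd] prob_le_1)
  then have "P \<ge> 1" using sums(1) by (simp add: prob_nonneg[OF psd])
  have "Q \<le> (\<Sum>j\<in>J. prob \<rho> b j powr 1)"
    unfolding Q_def using \<alpha>\<beta> by (intro sum_mono powr_mono') (auto simp: prob_nonneg[OF psd] prob_le_1')
  then have "Q \<le> 1" using sums(2) by (simp add: prob_nonneg[OF psd])
  \<comment> \<open>This is (c^(-2))^(1 - \<alpha>), so (k - 1)/(1 - \<alpha>) is the deformed
    logarithm in the claim.\<close>
  define k where "k = c powr (2 * (\<alpha> - 1))"
  have "ln Q \<le> ln (k * P powr (\<alpha> / \<beta>))"
    using power_sum_inequality[OF assms(1-5) c \<alpha>\<beta>] \<open>c > 0\<close> \<open>P > 0\<close>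
    by (simp add: P_def Q_def k_def ln_mult ln_powr)
  then have "Q \<le> k * P powr (\<alpha> / \<beta>)"
    using \<open>Q > 0\<close> \<open>P > 0\<close> \<open>c > 0\<close> by (subst (asm) ln_le_cancel_iff) (auto simp: k_def)
  then have "Q - k \<le> \<alpha> / \<beta> * (P - 1)"
    using \<open>Q > 0\<close> \<open>Q \<le> 1\<close> \<open>P \<ge> 1\<close> \<alpha>\<beta> by (intro diff_le_of_powr_bound) auto
  moreover note \<open>\<alpha> / \<beta> = (\<alpha> - 1) / (1 - \<beta>)\<close>
  ultimately have "(Q - k) / (\<alpha> - 1) \<le> (\<alpha> - 1) / (1 - \<beta>) * (P - 1) / (\<alpha> - 1)"
    using \<alpha>\<beta> by (intro divide_right_mono) auto
  also have "\<dots> = (P - 1) / (1 - \<beta>)" using \<alpha>\<beta> by simp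
  finally have "(k - 1) / (1 - \<alpha>) \<le> (Q - 1) / (1 - \<alpha>) + (P - 1) / (1 - \<beta>)"
    using minus_divide_right[of "Q - k" "\<alpha> - 1"] by (simp add: diff_divide_distrib)
  moreover have "ln_alpha \<alpha> (c powr (-2)) = (k - 1) / (1 - \<alpha>)"
    using \<alpha>\<beta> by (simp add: ln_alpha_def k_def powr_powr algebra_simps)
  ultimately show ?thesis
    using \<alpha>\<beta> \<open>\<beta> < 1\<close> assms(1,2)
    by (simp add: tsallis_entropy_def sum_powr_support prob_nonneg[OF psd] P_def Q_def)
qed

lemma tsallis_uncertainty:
  fixes a :: "'i \<Rightarrow> complex ^ 'n" and b :: "'j \<Rightarrow> complex ^ 'n" and \<rho> :: "complex ^ 'n ^ 'n"
  assumes "finite I" "finite J" "resolution I a" "resolution J b" "density_matrix \<rho>"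
    and c: "\<And>i j. i \<in> I \<Longrightarrow> j \<in> J \<Longrightarrow> cmod (cinner (a i) (b j)) \<le> c"
    and \<alpha>\<beta>: "\<alpha> > 0" "\<beta> > 0" "1 / \<alpha> + 1 / \<beta> = 2"
  shows "tsallis_entropy \<alpha> I (prob \<rho> a) + tsallis_entropy \<beta> J (prob \<rho> b) \<ge> ln_alpha (max \<alpha> \<beta>) (c powr (-2))"
proof -
  have c': "cmod (cinner (b j) (a i)) \<le> c" if "j \<in> J" "i \<in> I" for i j
    using c[OF that(2,1)] by (subst cinner_commute) simp
  have "1 / \<beta> = 2 - 1 / \<alpha>" using \<alpha>\<beta> by linarith
  consider "\<alpha> > 1" "\<beta> < 1" | "\<alpha> < 1" "\<beta> > 1" | "\<alpha> = 1" "\<beta> = 1"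
    using \<alpha>\<beta> by (smt (verit) divide_less_eq_1_pos less_divide_eq_1_pos div_by_1)
  then show ?thesis
  proof cases
    case 1
    then show ?thesis
      using tsallis_uncertainty_gt_one[OF assms(2,1,4,3,5) c' _ \<alpha>\<beta>(2,3)] by simp
  next
    case 2
    then show ?thesis
      using tsallis_uncertainty_gt_one[OF assms(1,2,3,4,5) c _ \<alpha>\<beta>(1)] \<alpha>\<beta>(3) by (simp add: add.commute)
  next
    case 3
    \<comment> \<open>At order 1 both entropies are Shannon entropies and \<open>ln_alpha\<close> is
      ln, so the Renyi bound is the claim.\<close>
    have "c > 0" by (rule overlap_bound_pos[OF assms(3,4,5) c])
    then show ?thesis
      using renyi_uncertainty[OF assms] 3
      by (simp add: renyi_entropy_def tsallis_entropy_def ln_alpha_def ln_powr)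
  qed
qed

section \<open>Application to SIC-POVMs\<close>

text \<open>The scaling makes each effect the ketbra of one vector with itself; two such factors
  give the 1/d in \<open>sic_fbar\<close>.\<close>

definition sic_vector :: "(nat \<Rightarrow> complex ^ 'n) \<Rightarrow> nat \<Rightarrow> complex ^ 'n" where
  "sic_vector \<phi> j = of_real (1 / sqrt (real CARD('n))) *s \<phi> j"

lemma resolution_sic_vector:
  fixes \<phi> :: "nat \<Rightarrow> complex ^ 'n"
  assumes "sic_povm \<phi>"
  shows "resolution (sic_indices \<phi>) (sic_vector \<phi>)"
proof -
  have "ketbra (sic_vector \<phi> j) (sic_vector \<phi> j) $ k $ l = sic_effect \<phi> j $ k $ l" for j k l
  proof -
    have "complex_of_real (1 / sqrt (real CARD('n))) * of_real (1 / sqrt (real CARD('n))) =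
        of_real (1 / real CARD('n))"
      by (simp flip: of_real_mult)
    then show ?thesis
      by (simp add: ketbra_def sic_vector_def sic_effect_def)
        (simp add: scaleR_conv_of_real field_simps)
  qed
  then have "ketbra (sic_vector \<phi> j) (sic_vector \<phi> j) = sic_effect \<phi> j" for j
    by (simp add: vec_eq_iff)
  then show ?thesis using assms by (simp add: resolution_def sic_povm_def)
qed

lemma prob_sic_vector: "prob \<rho> (sic_vector \<phi>) = sic_prob \<phi> \<rho>"
  by (simp add: fun_eq_iff prob_def sic_vector_def form_scale sic_prob_def norm_divide power_divide)

lemma overlap_sic_vector:
  fixes \<phi> \<psi> :: "nat \<Rightarrow> complex ^ 'n"
  assumes "i \<in> sic_indices \<phi>" "j \<in> sic_indices \<psi>"
  shows "cmod (cinner (sic_vector \<phi> i) (sic_vector \<psi> j)) \<le> sic_fbar \<phi> \<psi>"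
proof -
  \<comment> \<open>As the image of a finite product the set is finite, so \<open>Max\<close> bounds
    its members.\<close>
  have "{cmod (cinner (\<phi> i) (\<psi> j)) | i j. i \<in> sic_indices \<phi> \<and> j \<in> sic_indices \<psi>} =
      (\<lambda>(i, j). cmod (cinner (\<phi> i) (\<psi> j))) ` (sic_indices \<phi> \<times> sic_indices \<psi>)"
    by auto
  then have "finite {cmod (cinner (\<phi> i) (\<psi> j)) | i j. i \<in> sic_indices \<phi> \<and> j \<in> sic_indices \<psi>}"
    by (simp add: sic_indices_def)
  then have "cmod (cinner (\<phi> i) (\<psi> j)) \<le>
      Max {cmod (cinner (\<phi> i) (\<psi> j)) | i j. i \<in> sic_indices \<phi> \<and> j \<in> sic_indices \<psi>}"
    using assms by (intro Max_ge) auto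
  moreover have "cmod (cinner (sic_vector \<phi> i) (sic_vector \<psi> j)) =
      1 / real CARD('n) * cmod (cinner (\<phi> i) (\<psi> j))"
    by (simp add: sic_vector_def cinner_scale_left cinner_scale_right norm_mult norm_divide)
  ultimately show ?thesis
    unfolding sic_fbar_def by (simp add: divide_right_mono)
qed

theorem mainTheorem12:
  fixes \<phi> \<psi> :: "nat \<Rightarrow> complex ^ 'n"
    and \<rho> :: "complex ^ 'n ^ 'n"
    and \<alpha> \<beta> \<mu> :: real
  assumes "sic_povm \<phi>" and "sic_povm \<psi>"
    and "density_matrix \<rho>"
    and "\<alpha> > 0" and "\<beta> > 0" and "1 / \<alpha> + 1 / \<beta> = 2"
    and "\<mu> = max \<alpha> \<beta>"
  shows "sic_tsallis \<alpha> \<phi> \<rho> + sic_tsallis \<beta> \<psi> \<rho> \<ge> ln_alpha \<mu> (sic_fbar \<phi> \<psi> powi (-2)) \<and>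
         sic_renyi \<alpha> \<phi> \<rho> + sic_renyi \<beta> \<psi> \<rho> \<ge> - 2 * ln (sic_fbar \<phi> \<psi>)"
proof -
  have fin: "finite (sic_indices \<phi>)" "finite (sic_indices \<psi>)"
    by (simp_all add: sic_indices_def)
  note res = resolution_sic_vector[OF assms(1)] resolution_sic_vector[OF assms(2)] assms(3)
  note hyps = fin res overlap_sic_vector assms(4-6)
  \<comment> \<open>Positivity allows the integer power in the statement to be read as a real
    power.\<close>
  have "sic_fbar \<phi> \<psi> > 0"
    by (rule overlap_bound_pos[OF res overlap_sic_vector])
  then have "sic_fbar \<phi> \<psi> powi (-2) = sic_fbar \<phi> \<psi> powr (-2)"
    using powr_real_of_int'[of "sic_fbar \<phi> \<psi>" "-2"] by simp
  then show ?thesis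
    using tsallis_uncertainty[OF hyps] renyi_uncertainty[OF hyps] assms(7)
    by (simp add: prob_sic_vector sic_tsallis_def sic_renyi_def)
qed

end
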